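(* Let $G$ be a 2-connected graph with $n$ vertices. Then $$Kf(G) \leq \frac{n^3-n}{12},$$ with equality if and only if $G = C_n$, the cycle on $n$ vertices.
   Context: All graphs are finite, simple and undirected. For a connected graph $G$ and vertices $u,v$, the resistance distance $\Omega_G(u,v)$ is the effective resistance between $u$ and $v$ in the electrical network obtained from $G$ by replacing each edge with a unit resistor. The Kirchhoff index is $Kf(G)=\sum_{\{u,v\}\subseteq V(G)}\Omega_G(u,v)$, the sum over unordered pairs of distinct vertices. A graph is 2-connected if it is connected, has at least three vertices, and has no cut vertex. *)

theory Defs
  imports Complex_Main "Graph_Theory.Graph_Theory"
begin

text \<open>
  A finite simple undirected graph is a \<^locale>\<open>pair_graph\<close>: a finite vertex set with a finite,
  symmetric, loop-free set of ordered pairs as arcs. An undirected edge between \<open>x\<close> and \<open>y\<close> is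
  the pair of arcs \<open>(x, y)\<close> and \<open>(y, x)\<close>.
\<close>

text \<open>
  The potential \<open>f\<close> drives a unit current from \<open>u\<close> to \<open>v\<close> through the network with a unit resistor
  on each edge. By Ohm's law the current from \<open>x\<close> to a neighbour \<open>y\<close> is \<open>f x - f y\<close>; the
  condition is Kirchhoff's current law at every vertex.
\<close>
definition unit_current_potential :: "'a pair_pre_digraph \<Rightarrow> 'a \<Rightarrow> 'a \<Rightarrow> ('a \<Rightarrow> real) \<Rightarrow> bool" where
  "unit_current_potential G u v f \<longleftrightarrow>
     (\<forall>x \<in> pverts G. (\<Sum>y | (x, y) \<in> parcs G. f x - f y) = of_bool (x = u) - of_bool (x = v))"

text \<open>
  In a connected graph the potential exists and is unique on the vertices up to an additive
  constant, so that the potential difference is well defined; for other graphs the value is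
  meaningless.
\<close>
definition resistance_distance :: "'a pair_pre_digraph \<Rightarrow> 'a \<Rightarrow> 'a \<Rightarrow> real" where
  "resistance_distance G u v = (THE r. \<exists>f. unit_current_potential G u v f \<and> r = f u - f v)"

text \<open>
  The sum ranges over two-element vertex sets; the description operator selects the common value
  of \<open>resistance_distance G u v\<close> and \<open>resistance_distance G v u\<close>, see \<open>resistance_distance_pair\<close>.
\<close>
definition Kirchhoff_index :: "'a pair_pre_digraph \<Rightarrow> real" where
  "Kirchhoff_index G =
     (\<Sum>e | e \<subseteq> pverts G \<and> card e = 2. THE r. \<exists>u v. e = {u, v} \<and> r = resistance_distance G u v)"

lemma unit_current_potential_uminus:
  assumes "unit_current_potential G u v f"
  shows "unit_current_potential G v u (\<lambda>x. - f x)"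
  unfolding unit_current_potential_def
proof
  fix x assume "x \<in> pverts G"
  then have "(\<Sum>y | (x, y) \<in> parcs G. f x - f y) = of_bool (x = u) - of_bool (x = v)"
    using assms by (simp add: unit_current_potential_def)
  moreover have "(\<Sum>y | (x, y) \<in> parcs G. - f x - - f y) = - (\<Sum>y | (x, y) \<in> parcs G. f x - f y)"
    unfolding sum_negf[symmetric] by (rule sum.cong) auto
  ultimately show "(\<Sum>y | (x, y) \<in> parcs G. - f x - - f y) = of_bool (x = v) - of_bool (x = u)"
    by simp
qed

lemma resistance_distance_commute: "resistance_distance G u v = resistance_distance G v u"
proof -
  have "\<exists>f. unit_current_potential G v u f \<and> r = f v - f u"
    if "unit_current_potential G u v f" "r = f u - f v" for r f and u v :: 'a
    using unit_current_potential_uminus[OF that(1)] that(2) by (intro exI[of _ "\<lambda>x. - f x"]) simp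
  then have "(\<exists>f. unit_current_potential G u v f \<and> r = f u - f v) \<longleftrightarrow>
      (\<exists>f. unit_current_potential G v u f \<and> r = f v - f u)" for r
    by metis
  then show ?thesis
    by (simp add: resistance_distance_def)
qed

lemma resistance_distance_pair:
  "(THE r. \<exists>u v. {x, y} = {u, v} \<and> r = resistance_distance G u v) = resistance_distance G x y"
  by (rule the_equality) (auto simp: doubleton_eq_iff resistance_distance_commute)

definition cut_vertex :: "'a pair_pre_digraph \<Rightarrow> 'a \<Rightarrow> bool" where
  "cut_vertex G v \<longleftrightarrow> v \<in> pverts G \<and>
     (\<exists>x \<in> pverts G - {v}. \<exists>y \<in> pverts G - {v}.
        x \<rightarrow>\<^sup>*\<^bsub>with_proj G\<^esub> y \<and> \<not> x \<rightarrow>\<^sup>*\<^bsub>pre_digraph.del_vert (with_proj G) v\<^esub> y)"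

definition two_connected :: "'a pair_pre_digraph \<Rightarrow> bool" where
  "two_connected G \<longleftrightarrow>
     Digraph_Component.connected (with_proj G) \<and> card (pverts G) \<ge> 3 \<and> (\<nexists>v. cut_vertex G v)"

text \<open>Intended for \<open>n \<ge> 3\<close>; for smaller \<open>n\<close> this is not a cycle.\<close>
definition cycle_graph :: "nat \<Rightarrow> nat pair_pre_digraph" where
  "cycle_graph n =
     \<lparr>pverts = {..<n},
      parcs = {(i, j). i < n \<and> j < n \<and> (j = Suc i mod n \<or> i = Suc j mod n)}\<rparr>"

end

theory Submission
  imports Defs "HOL-Library.Sublist"
begin

text \<open>
  Fix a vertex \<open>s\<close> and a neighbour \<open>t\<close>. A 2-connected graph has an \<open>st\<close>-numbering \<open>N\<close> with values
  \<open>0, \<dots>, n - 1\<close>: every vertex other than \<open>s\<close> and \<open>t\<close> has a neighbour with a smaller and one with a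
  larger number. If \<open>N x = i\<close>, then a descending path from \<open>x\<close> to \<open>s\<close> and an ascending path from
  \<open>x\<close> to \<open>t\<close>, continued by the edge \<open>ts\<close>, are edge-disjoint of length at most \<open>i\<close> and \<open>n - i\<close>.
  Two such paths in parallel give \<open>\<Omega>(s, x) \<le> i (n - i) / n\<close>, which is the value in the cycle, and
  summing over \<open>x\<close> yields \<open>(n\<^sup>2 - 1) / 6\<close>. An edge that skips a number shortens a descending path
  from \<open>t\<close>, so equality forces all edges but \<open>ts\<close> to join consecutive numbers.
\<close>

section \<open>Potentials and resistance distance\<close>

locale connected_pair_graph = pair_graph +
  assumes connected: "Digraph_Component.connected (with_proj G)"
begin

lemma reachable_all:
  assumes "x \<in> pverts G" "y \<in> pverts G"
  shows "(x, y) \<in> rtrancl_on (pverts G) (parcs G)"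
proof -
  have "x \<rightarrow>\<^sup>*\<^bsub>with_proj G\<^esub> y"
    using symmetric_connected_imp_strongly_connected[OF pair_sym_arcs connected] assms
    by (simp add: strongly_connected_def)
  then show ?thesis
    by (simp add: reachable_def)
qed

lemma locally_constant_imp_constant:
  assumes "\<And>x y. (x, y) \<in> parcs G \<Longrightarrow> h x = h y" "x \<in> pverts G" "y \<in> pverts G"
  shows "h x = h y"
  using reachable_all[OF assms(2,3)] by induct (use assms(1) in auto)

end

section \<open>The Laplacian and the energy identity\<close>

definition laplacian :: "'a pair_pre_digraph \<Rightarrow> ('a \<Rightarrow> real) \<Rightarrow> 'a \<Rightarrow> real" where
  "laplacian G f x = (\<Sum>y | (x, y) \<in> parcs G. f x - f y)"

lemma unit_current_potential_iff:
  "unit_current_potential G u v f \<longleftrightarrow>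
     (\<forall>x \<in> pverts G. laplacian G f x = of_bool (x = u) - of_bool (x = v))"
  by (simp add: unit_current_potential_def laplacian_def)

lemma laplacian_add: "laplacian G (\<lambda>x. f x + g x) x = laplacian G f x + laplacian G g x"
  by (simp add: laplacian_def sum.distrib[symmetric] algebra_simps)

lemma laplacian_cmult: "laplacian G (\<lambda>x. c * f x) x = c * laplacian G f x"
  by (simp add: laplacian_def sum_distrib_left algebra_simps)

lemma laplacian_diff: "laplacian G (\<lambda>x. f x - g x) x = laplacian G f x - laplacian G g x"
  by (simp add: laplacian_def sum_subtractf[symmetric] algebra_simps)

context pair_graph
begin

lemma sum_arcs_swap: "(\<Sum>(x, y) \<in> parcs G. g x y) = (\<Sum>(x, y) \<in> parcs G. g y x)"
  by (rule sum.reindex_bij_witness[where i = prod.swap and j = prod.swap])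
    (auto intro: arcs_symmetric)

lemma sum_mult_laplacian:
  "(\<Sum>x \<in> pverts G. g x * laplacian G f x) = (\<Sum>(x, y) \<in> parcs G. g x * (f x - f y))"
proof -
  have "(\<Sum>x \<in> pverts G. g x * laplacian G f x) =
      (\<Sum>x \<in> pverts G. \<Sum>y | (x, y) \<in> parcs G. g x * (f x - f y))"
    by (simp add: laplacian_def sum_distrib_left)
  also have "\<dots> = (\<Sum>(x, y) \<in> Sigma (pverts G) (\<lambda>x. {y. (x, y) \<in> parcs G}). g x * (f x - f y))"
  proof (rule sum.Sigma)
    show "\<forall>x \<in> pverts G. finite {y. (x, y) \<in> parcs G}"
      using pair_finite_verts by (auto intro: finite_subset[of _ "pverts G"] dest: in_arcsD2)
  qed (simp add: pair_finite_verts)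
  also have "Sigma (pverts G) (\<lambda>x. {y. (x, y) \<in> parcs G}) = parcs G"
    by (auto dest: in_arcsD1)
  finally show ?thesis .
qed

lemma sum_laplacian: "(\<Sum>x \<in> pverts G. laplacian G f x) = 0"
proof -
  have "(\<Sum>(x, y) \<in> parcs G. f x - f y) = (\<Sum>(x, y) \<in> parcs G. f y - f x)"
    by (rule sum_arcs_swap)
  also have "\<dots> = - (\<Sum>(x, y) \<in> parcs G. f x - f y)"
    by (simp add: sum_negf[symmetric] case_prod_unfold)
  finally show ?thesis
    using sum_mult_laplacian[of "\<lambda>_. 1" f] by simp
qed

text \<open>Summation by parts: reversing arcs pairs \<open>f x * (f x - f y)\<close> with
  \<open>f y * (f y - f x)\<close>, and the two add up to the square.\<close>

lemma energy_eq: "(\<Sum>(x, y) \<in> parcs G. (f x - f y)\<^sup>2) = 2 * (\<Sum>x \<in> pverts G. f x * laplacian G f x)"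
proof -
  have "(\<Sum>(x, y) \<in> parcs G. (f x - f y)\<^sup>2) =
      (\<Sum>(x, y) \<in> parcs G. f x * (f x - f y)) + (\<Sum>(x, y) \<in> parcs G. f y * (f y - f x))"
    by (simp add: sum.distrib[symmetric] case_prod_unfold power2_eq_square algebra_simps)
  then show ?thesis
    using sum_arcs_swap[of "\<lambda>x y. f x * (f x - f y)"] sum_mult_laplacian[of f f] by simp
qed

text \<open>The first hypothesis makes the energy vanish, hence every square in it. This serves both
  for the nonzero pivot of the elimination and for the uniqueness of potentials.\<close>

lemma energy_zero_imp:
  assumes "\<And>x. x \<in> pverts G \<Longrightarrow> f x * laplacian G f x = 0" "(x, y) \<in> parcs G"
  shows "f x = f y"
proof -
  have "(\<Sum>(x, y) \<in> parcs G. (f x - f y)\<^sup>2) = 0"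
    unfolding energy_eq using assms(1) by (subst sum.neutral) auto
  then have "\<forall>e \<in> parcs G. (case e of (x, y) \<Rightarrow> (f x - f y)\<^sup>2) = 0"
    by (subst (asm) sum_nonneg_eq_0_iff) (auto simp: pair_finite_arcs)
  then show ?thesis
    using assms(2) by auto
qed

text \<open>Dissipated power is voltage times current, and the current is 1; the factor 2 counts
  each edge in both directions.\<close>

lemma energy_potential:
  assumes "unit_current_potential G u v f" "u \<in> pverts G" "v \<in> pverts G"
  shows "(\<Sum>(x, y) \<in> parcs G. (f x - f y)\<^sup>2) = 2 * (f u - f v)"
proof -
  have "(\<Sum>x \<in> pverts G. f x * laplacian G f x) =
      (\<Sum>x \<in> pverts G. (if x = u then f x else 0) - (if x = v then f x else 0))"
    using assms(1) by (intro sum.cong) (auto simp: unit_current_potential_iff)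
  also have "\<dots> = f u - f v"
    using assms(2,3) pair_finite_verts by (simp add: sum_subtractf)
  finally show ?thesis
    by (simp add: energy_eq)
qed

end

section \<open>Existence and uniqueness of potentials\<close>

context connected_pair_graph
begin

text \<open>Gaussian elimination: a solution on \<open>insert z S\<close> combines a solution on \<open>S\<close> with the function
  that is 1 at \<open>z\<close> and harmonic on \<open>S\<close>; the pivot is nonzero
  by the energy identity.\<close>
lemma grounded_poisson_solvable:
  assumes "finite S" "S \<subset> pverts G"
  shows "\<exists>f. (\<forall>x. x \<notin> S \<longrightarrow> f x = 0) \<and> (\<forall>x \<in> S. laplacian G f x = b x)"
  using assms
proof (induction S arbitrary: b)
  case empty
  show ?case by (intro exI[of _ "\<lambda>_. 0"]) simp
next
  case (insert z S)
  have S: "S \<subset> pverts G" using insert.prems by auto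
  obtain f where f: "\<And>x. x \<notin> S \<Longrightarrow> f x = 0" "\<And>x. x \<in> S \<Longrightarrow> laplacian G f x = b x"
    using insert.IH[OF S, of b] by auto
  obtain g where g: "\<And>x. x \<notin> S \<Longrightarrow> g x = 0"
      "\<And>x. x \<in> S \<Longrightarrow> laplacian G g x = - laplacian G (\<lambda>x. of_bool (x = z)) x"
    using insert.IH[OF S, of "\<lambda>x. - laplacian G (\<lambda>x. of_bool (x = z)) x"] by auto
  define h where "h x = g x + of_bool (x = z)" for x
  have h: "h x = 0" if "x \<notin> insert z S" for x
    using that g(1) by (simp add: h_def)
  have h_z: "h z = 1"
    using g(1) insert.hyps by (simp add: h_def)
  have h_harm: "laplacian G h x = 0" if "x \<in> S" for x
    unfolding h_def laplacian_add using g(2)[OF that] by simp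
  have pivot: "laplacian G h z \<noteq> 0"
  proof
    assume "laplacian G h z = 0"
    then have "h x * laplacian G h x = 0" for x
      using h[of x] h_harm[of x] by (cases "x \<in> insert z S") auto
    then have "h x = h y" if "(x, y) \<in> parcs G" for x y
      using energy_zero_imp that by blast
    moreover obtain w where "w \<in> pverts G" "w \<notin> insert z S"
      using insert.prems by blast
    ultimately have "h z = h w"
      using insert.prems locally_constant_imp_constant[of h z w] by blast
    then show False
      using h_z h[OF \<open>w \<notin> insert z S\<close>] by simp
  qed
  define c where "c = (b z - laplacian G f z) / laplacian G h z"
  have "laplacian G (\<lambda>x. f x + c * h x) x = b x" if "x \<in> insert z S" for x
    unfolding laplacian_add laplacian_cmult
    using that pivot f(2) h_harm by (auto simp: c_def)
  then show ?case
    using f(1) h by (intro exI[of _ "\<lambda>x. f x + c * h x"]) auto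
qed

text \<open>Grounding \<open>v\<close> solves the equations at all other vertices; the one at
  \<open>v\<close> follows because both sides sum to zero over the graph.\<close>

lemma unit_current_potential_exists:
  assumes "u \<in> pverts G" "v \<in> pverts G"
  obtains f where "unit_current_potential G u v f"
proof -
  let ?b = "\<lambda>x. of_bool (x = u) - of_bool (x = v) :: real"
  obtain f where f: "\<And>x. x \<in> pverts G - {v} \<Longrightarrow> laplacian G f x = ?b x"
    using grounded_poisson_solvable[of "pverts G - {v}" ?b] assms pair_finite_verts by blast
  have "(\<Sum>x \<in> pverts G. laplacian G f x - ?b x) = 0"
    using assms pair_finite_verts sum_laplacian by (simp add: sum_subtractf of_bool_def)
  moreover have "(\<Sum>x \<in> pverts G - {v}. laplacian G f x - ?b x) = 0"
    using f by simp
  ultimately have "laplacian G f v = ?b v"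
    using assms(2) pair_finite_verts by (simp add: sum.remove[of "pverts G" v])
  with f have "unit_current_potential G u v f"
    unfolding unit_current_potential_iff by blast
  then show thesis by (rule that)
qed

text \<open>Two potentials differ by a function with zero Laplacian, thus of zero energy, thus
  constant by connectedness; so the described value is unique.\<close>

lemma resistance_distance_eq:
  assumes "unit_current_potential G u v f" "u \<in> pverts G" "v \<in> pverts G"
  shows "resistance_distance G u v = f u - f v"
  unfolding resistance_distance_def
proof (rule the_equality)
  fix r assume "\<exists>g. unit_current_potential G u v g \<and> r = g u - g v"
  then obtain g where g: "unit_current_potential G u v g" "r = g u - g v" by blast
  define h where "h x = f x - g x" for x
  have "laplacian G h x = 0" if "x \<in> pverts G" for x
    unfolding h_def laplacian_diff
    using assms(1) g(1) that by (simp add: unit_current_potential_iff)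
  then have "h x = h y" if "(x, y) \<in> parcs G" for x y
    using energy_zero_imp that by simp
  then have "h u = h v"
    using locally_constant_imp_constant assms(2,3) by blast
  then show "r = f u - f v"
    using g(2) by (simp add: h_def)
qed (use assms in blast)

lemma resistance_distance_self: "u \<in> pverts G \<Longrightarrow> resistance_distance G u u = 0"
  by (metis unit_current_potential_exists resistance_distance_eq diff_self)

text \<open>Each two-element set comes from exactly two ordered pairs, with equal resistance by
  symmetry; the diagonal adds 0.\<close>

lemma Kirchhoff_index_eq_sum:
  "Kirchhoff_index G = (\<Sum>u \<in> pverts G. \<Sum>v \<in> pverts G. resistance_distance G u v) / 2"
proof -
  let ?V = "pverts G"
  let ?P = "{(u, v). u \<in> ?V \<and> v \<in> ?V \<and> u \<noteq> v}"
  let ?E = "{e. e \<subseteq> ?V \<and> card e = 2}"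
  let ?\<Omega> = "\<lambda>(u, v). resistance_distance G u v"
  have fin: "finite ?P" "finite ?E"
    using pair_finite_verts by (auto intro: finite_subset[of _ "?V \<times> ?V"])
  have "(\<Sum>u \<in> ?V. \<Sum>v \<in> ?V. resistance_distance G u v) = sum ?\<Omega> (?V \<times> ?V)"
    by (simp add: sum.cartesian_product)
  also have "\<dots> = sum ?\<Omega> ?P"
    by (rule sum.mono_neutral_right) (auto simp: pair_finite_verts resistance_distance_self)
  also have "\<dots> = (\<Sum>e \<in> ?E. sum ?\<Omega> {p \<in> ?P. (\<lambda>(u, v). {u, v}) p = e})"
    by (rule sum.group[symmetric]) (use fin in \<open>auto simp: card_2_iff\<close>)
  also have "\<dots> = (\<Sum>e \<in> ?E. 2 * (THE r. \<exists>u v. e = {u, v} \<and> r = resistance_distance G u v))"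
  proof (rule sum.cong)
    fix e assume "e \<in> ?E"
    then obtain x y where xy: "e = {x, y}" "x \<noteq> y" "x \<in> ?V" "y \<in> ?V"
      by (auto simp: card_2_iff)
    then have "{p \<in> ?P. (\<lambda>(u, v). {u, v}) p = e} = {(x, y), (y, x)}"
      by (auto simp: doubleton_eq_iff)
    then show "sum ?\<Omega> {p \<in> ?P. (\<lambda>(u, v). {u, v}) p = e} =
        2 * (THE r. \<exists>u v. e = {u, v} \<and> r = resistance_distance G u v)"
      using xy resistance_distance_commute[of G x y] by (simp add: resistance_distance_pair)
  qed simp
  also have "\<dots> = 2 * Kirchhoff_index G"
    by (simp add: Kirchhoff_index_def sum_distrib_left)
  finally show ?thesis by simp
qed

end

section \<open>Existence of st-numberings\<close>

lemma subseq_pair_nth: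
  assumes "subseq [a, b] xs"
  obtains i j where "i < j" "j < length xs" "xs ! i = a" "xs ! j = b"
proof -
  obtain us vs where xs: "xs = us @ a # vs" and "subseq [b] vs"
    using assms by (auto dest!: list_emb_ConsD)
  then have "b \<in> set vs"
    by (simp add: subseq_singleton_left)
  then obtain k where "k < length vs" "vs ! k = b"
    by (auto simp: in_set_conv_nth)
  with xs show thesis
    by (intro that[of "length us" "length us + Suc k"]) (auto simp: nth_append)
qed

text \<open>The part of a walk into \<open>S\<close> before its first vertex in \<open>S\<close>, with loops erased.\<close>
lemma rtrancl_on_path_to_set:
  assumes "(p, z) \<in> rtrancl_on F r" "p \<notin> S" "z \<in> S"
  shows "\<exists>ps y. ps \<noteq> [] \<and> hd ps = p \<and> distinct ps \<and> set ps \<subseteq> F - S \<and> y \<in> S \<inter> F \<and>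
    successively (\<lambda>a b. (a, b) \<in> r) (ps @ [y])"
  using assms
proof (induction rule: converse_rtrancl_on_induct)
  case base
  then show ?case by simp
next
  case (step p q)
  show ?case
  proof (cases "q \<in> S")
    case True
    with step show ?thesis by (intro exI[of _ "[p]"] exI[of _ q]) auto
  next
    case False
    then obtain ps y where ps: "ps \<noteq> []" "hd ps = q" "distinct ps" "set ps \<subseteq> F - S" "y \<in> S \<inter> F"
        "successively (\<lambda>a b. (a, b) \<in> r) (ps @ [y])"
      using step by blast
    show ?thesis
    proof (cases "p \<in> set ps")
      case True
      then obtain us vs where "ps = us @ p # vs"
        by (auto simp: in_set_conv_decomp)
      with ps show ?thesis
        by (intro exI[of _ "p # vs"] exI[of _ y]) (auto simp: successively_append_iff)
    next
      case False
      with ps step show ?thesis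
        by (intro exI[of _ "p # ps"] exI[of _ y]) (auto simp: successively_Cons)
    qed
  qed
qed

section \<open>Open ears and vertex orders built from them\<close>

locale two_connected_pair_graph = pair_graph +
  assumes two_connected: "two_connected G"
begin

sublocale connected_pair_graph
  using two_connected by unfold_locales (simp add: two_connected_def)

lemma card_verts_ge: "3 \<le> card (pverts G)"
  using two_connected by (simp add: two_connected_def)

text \<open>The absence of cut vertices in the \<open>rtrancl_on\<close> form that
  \<open>rtrancl_on_path_to_set\<close> takes as input.\<close>

lemma reachable_avoiding:
  assumes "v \<in> pverts G" "x \<in> pverts G - {v}" "y \<in> pverts G - {v}"
  shows "(x, y) \<in> rtrancl_on (pverts G - {v}) {(a, b) \<in> parcs G. a \<noteq> v \<and> b \<noteq> v}"
proof -
  have "\<not> cut_vertex G v"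
    using two_connected by (simp add: two_connected_def)
  moreover have "x \<rightarrow>\<^sup>*\<^bsub>with_proj G\<^esub> y"
    using reachable_all assms by (simp add: reachable_def)
  ultimately have "x \<rightarrow>\<^sup>*\<^bsub>pre_digraph.del_vert (with_proj G) v\<^esub> y"
    using assms unfolding cut_vertex_def by blast
  moreover have "arcs_ends (pre_digraph.del_vert (with_proj G) v) =
      {(a, b) \<in> parcs G. a \<noteq> v \<and> b \<noteq> v}"
    by (auto simp: arcs_ends_def arc_to_ends_def pre_digraph.del_vert_def image_iff)
  ultimately show ?thesis
    by (simp add: reachable_def verts_del_vert)
qed

text \<open>Some arc leads from an \<open>x\<close> in \<open>S\<close> to a vertex outside. As
  \<open>x\<close> is no cut vertex, a path returns from there to \<open>S\<close> avoiding
  \<open>x\<close>, so the ear has two different ends.\<close>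

lemma ear_exists:
  assumes "S \<subset> pverts G" "s \<in> S" "t \<in> S" "s \<noteq> t"
  shows "\<exists>x y ps. x \<in> S \<and> y \<in> S \<and> x \<noteq> y \<and> ps \<noteq> [] \<and> distinct ps \<and> set ps \<subseteq> pverts G - S \<and>
    successively (\<lambda>a b. (a, b) \<in> parcs G) (x # ps @ [y])"
proof -
  obtain w where w: "w \<in> pverts G" "w \<notin> S" using assms(1) by blast
  have "(s, w) \<in> rtrancl_on (pverts G) (parcs G)"
    using reachable_all assms w by blast
  then have "w \<notin> S \<longrightarrow> (\<exists>x p. x \<in> S \<and> p \<notin> S \<and> (x, p) \<in> parcs G)"
    by (induct rule: rtrancl_on_induct) (use assms in auto)
  with w obtain x p where xp: "x \<in> S" "p \<notin> S" "(x, p) \<in> parcs G" by blast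
  obtain z where z: "z \<in> S" "z \<noteq> x" using assms by metis
  let ?r = "{(a, b) \<in> parcs G. a \<noteq> x \<and> b \<noteq> x}"
  have "(p, z) \<in> rtrancl_on (pverts G - {x}) ?r"
    using xp z assms(1) by (intro reachable_avoiding) (auto dest: in_arcsD2)
  from rtrancl_on_path_to_set[OF this xp(2) z(1)] obtain ps y where ps:
      "ps \<noteq> []" "hd ps = p" "distinct ps" "set ps \<subseteq> pverts G - {x} - S" "y \<in> S \<inter> (pverts G - {x})"
      "successively (\<lambda>a b. (a, b) \<in> ?r) (ps @ [y])"
    by blast
  from ps(6) have "successively (\<lambda>a b. (a, b) \<in> parcs G) (ps @ [y])"
    by (rule successively_mono) auto
  with ps(1,2) xp(3) have "successively (\<lambda>a b. (a, b) \<in> parcs G) (x # ps @ [y])"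
    by (auto simp: successively_Cons)
  with ps xp(1) show ?thesis by (intro exI[of _ x] exI[of _ y] exI[of _ ps]) auto
qed

text \<open>A partial order of construction: the list need not yet span the graph. In a distinct
  list \<open>subseq [y, v] xs\<close> says that \<open>y\<close> precedes \<open>v\<close>, and
  this form survives insertions by transitivity of \<open>subseq\<close>.\<close>

definition st_order :: "'a \<Rightarrow> 'a \<Rightarrow> 'a list \<Rightarrow> bool" where
  "st_order s t xs \<longleftrightarrow> distinct xs \<and> set xs \<subseteq> pverts G \<and> xs \<noteq> [] \<and> hd xs = s \<and> last xs = t \<and>
     (\<forall>v \<in> set xs - {s, t}. (\<exists>y. (v, y) \<in> parcs G \<and> subseq [y, v] xs) \<and>
        (\<exists>z. (v, z) \<in> parcs G \<and> subseq [v, z] xs))"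

text \<open>Placed right after \<open>x\<close>, the ear stands before \<open>y\<close>, so each
  inner vertex has its two ear neighbours on opposite sides. Old vertices keep their
  witnesses.\<close>

lemma st_order_insert_ear:
  assumes "st_order s t (us @ x # vs)" "y \<in> set vs" "ps \<noteq> []" "distinct ps"
    "set ps \<subseteq> pverts G - set (us @ x # vs)"
    "successively (\<lambda>a b. (a, b) \<in> parcs G) (x # ps @ [y])"
  shows "st_order s t (us @ x # ps @ vs)"
proof -
  let ?xs = "us @ x # vs" and ?ys = "us @ x # ps @ vs"
  note st = assms(1)[unfolded st_order_def]
  have sub: "subseq ?xs ?ys"
    by (auto intro!: subseq_append_le_same_iff[THEN iffD2] list_emb_append_mono)
  have "subseq [y] vs"
    using assms(2) by (simp add: subseq_singleton_left)
  then have sub_ear: "subseq (x # ps @ [y]) ?ys"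
    by (intro list_emb_append2 subseq_Cons2 list_emb_append_mono) auto
  have new: "(\<exists>a. (v, a) \<in> parcs G \<and> subseq [a, v] ?ys) \<and>
      (\<exists>b. (v, b) \<in> parcs G \<and> subseq [v, b] ?ys)" if v: "v \<in> set ps" for v
  proof -
    obtain as bs where ps: "ps = as @ v # bs"
      using v by (auto simp: in_set_conv_decomp)
    \<comment> \<open>The neighbours of \<open>v\<close> on the ear; they may be its ends
      \<open>x\<close> and \<open>y\<close>.\<close>
    define a b where "a = last (x # as)" and "b = hd (bs @ [y])"
    have "x # as = butlast (x # as) @ [a]" "bs @ [y] = b # tl (bs @ [y])"
      by (simp_all add: a_def b_def del: last.simps butlast.simps)
    then have ear: "x # ps @ [y] = butlast (x # as) @ a # v # b # tl (bs @ [y])"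
      unfolding ps by (metis append.assoc append_Cons append_Nil)
    have "(a, v) \<in> parcs G" "(v, b) \<in> parcs G"
      using assms(6) unfolding ear by (auto simp: successively_append_iff)
    moreover have "subseq [a, v] (x # ps @ [y])" "subseq [v, b] (x # ps @ [y])"
      unfolding ear by (auto intro!: list_emb_append2)
    ultimately show ?thesis
      using sub_ear subseq_order.trans arcs_symmetric by blast
  qed
  have old: "(\<exists>a. (v, a) \<in> parcs G \<and> subseq [a, v] ?ys) \<and>
      (\<exists>b. (v, b) \<in> parcs G \<and> subseq [v, b] ?ys)" if "v \<in> set ?xs - {s, t}" for v
    using st that sub subseq_order.trans by meson
  have "vs \<noteq> []" using assms(2) by auto
  then have "hd ?ys = s" "last ?ys = t"
    using st by (auto simp: hd_append)
  moreover have "distinct ?ys" "set ?ys \<subseteq> pverts G"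
    using st assms(4,5) by auto
  ultimately show ?thesis
    unfolding st_order_def using old new by auto
qed

text \<open>A longest order spans the graph, since otherwise an ear could be inserted;
  \<open>[s, t]\<close> is an order to start from.\<close>

lemma st_order_exists:
  assumes "s \<in> pverts G" "t \<in> pverts G" "s \<noteq> t"
  obtains xs where "st_order s t xs" "set xs = pverts G"
proof -
  have "st_order s t [s, t]"
    using assms by (auto simp: st_order_def)
  moreover have "length xs \<le> card (pverts G)" if "st_order s t xs" for xs
    using that pair_finite_verts card_mono distinct_card unfolding st_order_def by metis
  ultimately obtain xs where xs: "st_order s t xs"
      and max: "\<And>ys. st_order s t ys \<Longrightarrow> length ys \<le> length xs"
    using ex_has_greatest_nat[of "st_order s t" _ length "Suc (card (pverts G))"]
    by (metis le_imp_less_Suc)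
  have "set xs = pverts G"
  proof (rule ccontr)
    assume "set xs \<noteq> pverts G"
    with xs have "set xs \<subset> pverts G" by (auto simp: st_order_def)
    moreover have "s \<in> set xs" "t \<in> set xs"
      using xs by (auto simp: st_order_def)
    ultimately obtain x y ps where ear: "x \<in> set xs" "y \<in> set xs" "x \<noteq> y" "ps \<noteq> []" "distinct ps"
        "set ps \<subseteq> pverts G - set xs" "successively (\<lambda>a b. (a, b) \<in> parcs G) (x # ps @ [y])"
      using ear_exists assms(3) by metis
    have no_ext: False if "xs = us @ a # vs" "b \<in> set vs" "qs \<noteq> []" "distinct qs"
        "set qs \<subseteq> pverts G - set xs" "successively (\<lambda>a b. (a, b) \<in> parcs G) (a # qs @ [b])"
        for us a vs b qs
      using max[OF st_order_insert_ear[of s t us a vs b qs]] xs that by auto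
    obtain us vs where decomp: "xs = us @ x # vs"
      using ear(1) by (auto simp: in_set_conv_decomp)
    show False
    proof (cases "y \<in> set vs")
      case True
      then show False using no_ext decomp ear by blast
    next
      case False
      \<comment> \<open>Here \<open>y\<close> precedes \<open>x\<close>, so the ear is inserted
        backwards, after \<open>y\<close>.\<close>
      then obtain us1 us2 where "us = us1 @ y # us2"
        using decomp ear by (auto simp: in_set_conv_decomp)
      then have "xs = us1 @ y # (us2 @ x # vs)"
        using decomp by simp
      moreover have "successively (\<lambda>a b. (a, b) \<in> parcs G) (y # rev ps @ [x])"
      proof -
        have "successively (\<lambda>a b. (b, a) \<in> parcs G) (rev (x # ps @ [y]))"
          using ear(7) by (subst successively_rev) simp
        then have "successively (\<lambda>a b. (a, b) \<in> parcs G) (rev (x # ps @ [y]))"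
          by (rule successively_mono) (auto intro: arcs_symmetric)
        then show ?thesis by simp
      qed
      ultimately show False
        using no_ext[of us1 y "us2 @ x # vs" x "rev ps"] ear by auto
    qed
  qed
  with xs show thesis by (rule that)
qed

lemma st_numbering_exists:
  assumes "s \<in> pverts G" "t \<in> pverts G" "s \<noteq> t"
  obtains N where "bij_betw N (pverts G) {..<card (pverts G)}" "N s = 0" "N t = card (pverts G) - 1"
    "\<And>v. v \<in> pverts G - {s, t} \<Longrightarrow> \<exists>y. (v, y) \<in> parcs G \<and> N y < N v"
    "\<And>v. v \<in> pverts G - {s, t} \<Longrightarrow> \<exists>z. (v, z) \<in> parcs G \<and> N v < N z"
proof -
  obtain xs where "st_order s t xs" and set_xs: "set xs = pverts G"
    using st_order_exists assms by blast
  then have xs: "distinct xs" "xs \<noteq> []" "hd xs = s" "last xs = t"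
      "\<And>v. v \<in> pverts G - {s, t} \<Longrightarrow> \<exists>y. (v, y) \<in> parcs G \<and> subseq [y, v] xs"
      "\<And>v. v \<in> pverts G - {s, t} \<Longrightarrow> \<exists>z. (v, z) \<in> parcs G \<and> subseq [v, z] xs"
    by (auto simp: st_order_def)
  have len: "length xs = card (pverts G)"
    using xs(1) set_xs distinct_card by metis
  define N where "N = the_inv_into {..<length xs} ((!) xs)"
  have bij: "bij_betw ((!) xs) {..<length xs} (pverts G)"
    using xs(1) set_xs by (intro bij_betw_nth) auto
  then have N_nth: "N (xs ! i) = i" if "i < length xs" for i
    using that unfolding N_def by (intro the_inv_into_f_f) (auto simp: bij_betw_def)
  have N_less: "N a < N b" if "subseq [a, b] xs" for a b
    using that by (elim subseq_pair_nth) (metis N_nth less_trans)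
  show thesis
  proof
    show "bij_betw N (pverts G) {..<card (pverts G)}"
      using bij_betw_the_inv_into[OF bij] by (simp add: N_def len)
    show "N s = 0" "N t = card (pverts G) - 1"
      using N_nth[of 0] N_nth[of "length xs - 1"] xs by (auto simp: hd_conv_nth last_conv_nth len[symmetric])
  qed (use xs(5,6) N_less in blast)+
qed

end

section \<open>Resistance bounds from an st-numbering\<close>

text \<open>Inductive form of the Cauchy-Schwarz inequality: \<open>a\<close> stands for the drop
  along a walk of \<open>k\<close> edges with energy \<open>p\<close>, and \<open>b\<close> for the
  drop along one more edge.\<close>

lemma cauchy_schwarz_step:
  fixes a b k p :: real
  assumes "a\<^sup>2 \<le> k * p" "0 \<le> k" "0 \<le> p"
  shows "(a + b)\<^sup>2 \<le> (k + 1) * (p + b\<^sup>2)"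
proof (cases "k = 0")
  case True
  with assms show ?thesis by simp
next
  case False
  with assms have k: "0 < k" by simp
  have "0 \<le> (a - k * b)\<^sup>2 / k" using k by simp
  also have "\<dots> = a\<^sup>2 / k + k * b\<^sup>2 - 2 * a * b"
    using k by (simp add: power2_diff field_simps power2_eq_square)
  also have "a\<^sup>2 / k \<le> p" using k assms(1) by (simp add: field_simps)
  finally have "2 * a * b \<le> p + k * b\<^sup>2" by simp
  with assms(1) show ?thesis by (simp add: power2_sum algebra_simps)
qed

text \<open>Follow the given arcs from \<open>x\<close> down to \<open>s\<close>: descent of
  \<open>N\<close> makes them distinct, descent of \<open>l\<close> bounds their number by
  \<open>l x\<close>. Keeping \<open>l\<close> apart from \<open>N\<close> leaves room for
  shortcuts.\<close>

lemma sq_potential_drop_le_descending_energy: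
  fixes f :: "'a \<Rightarrow> real" and N l :: "'a \<Rightarrow> nat"
  assumes "finite A" "x \<in> V"
    and "\<And>x. x \<in> V \<Longrightarrow> x \<noteq> s \<Longrightarrow> \<exists>y \<in> V. (x, y) \<in> A \<and> N y < N x \<and> l y < l x"
  shows "(f x - f s)\<^sup>2 \<le> l x * (\<Sum>(p, q) \<in> {(p, q) \<in> A. N q < N p \<and> N p \<le> N x}. (f p - f q)\<^sup>2)"
  using assms(2)
proof (induction "N x" arbitrary: x rule: less_induct)
  case less
  let ?A = "\<lambda>x. {(p, q) \<in> A. N q < N p \<and> N p \<le> N x}"
  let ?E = "\<lambda>x. \<Sum>(p, q) \<in> ?A x. (f p - f q)\<^sup>2"
  have fin: "finite (?A z)" for z
    by (rule finite_subset[OF _ assms(1)]) auto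
  have nonneg: "0 \<le> ?E z" for z
    by (rule sum_nonneg) auto
  show ?case
  proof (cases "x = s")
    case True
    then show ?thesis using nonneg[of x] by simp
  next
    case False
    then obtain y where y: "y \<in> V" "(x, y) \<in> A" "N y < N x" "l y < l x"
      using assms(3) less.prems by blast
    have "(f y - f s)\<^sup>2 \<le> l y * ?E y"
      using less y by blast
    then have "((f y - f s) + (f x - f y))\<^sup>2 \<le> (real (l y) + 1) * (?E y + (f x - f y)\<^sup>2)"
      by (rule cauchy_schwarz_step) (use nonneg in simp_all)
    also have "\<dots> \<le> real (l x) * ?E x"
    proof (rule mult_mono)
      \<comment> \<open>The new arc is not in \<open>?A y\<close>, as its tail \<open>x\<close> has
        a larger number than \<open>y\<close>.\<close>
      have "?E y + (f x - f y)\<^sup>2 = (\<Sum>(p, q) \<in> insert (x, y) (?A y). (f p - f q)\<^sup>2)"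
        using fin y(3) by (subst sum.insert) auto
      also have "\<dots> \<le> ?E x"
        by (rule sum_mono2) (use fin y in auto)
      finally show "?E y + (f x - f y)\<^sup>2 \<le> ?E x" .
    qed (use y(4) nonneg[of y] in auto)
    finally show ?thesis by simp
  qed
qed

text \<open>The parallel law: \<open>r\<^sup>2 / a + r\<^sup>2 / b \<le> p + q \<le> r\<close>, and
  a factor \<open>r\<close> cancels unless it is 0.\<close>

lemma le_parallel_resistance:
  fixes r a b p q :: real
  assumes "r\<^sup>2 \<le> a * p" "r\<^sup>2 \<le> b * q" "p + q \<le> r" "0 < a" "0 < b" "0 \<le> p" "0 \<le> q"
  shows "r \<le> a * b / (a + b)"
proof -
  have "r * ((a + b) * r) = b * r\<^sup>2 + a * r\<^sup>2"
    by (simp add: power2_eq_square algebra_simps)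
  also have "\<dots> \<le> b * (a * p) + a * (b * q)"
    using assms by (intro add_mono mult_left_mono) auto
  also have "\<dots> = a * b * (p + q)"
    by (simp add: algebra_simps)
  also have "\<dots> \<le> a * b * r"
    using assms by (intro mult_left_mono) auto
  finally have "r * ((a + b) * r) \<le> r * (a * b)"
    by (simp add: algebra_simps)
  moreover have "0 \<le> r" using assms by linarith
  ultimately have "r = 0 \<or> (a + b) * r \<le> a * b"
    by (metis less_eq_real_def mult_le_cancel_left_pos)
  then show ?thesis
    using assms by (auto simp: field_simps)
qed

lemma sum_mult_diff:
  "(\<Sum>i<k. real i * (m - real i)) = real k * (real k - 1) * (3 * m - (2 * real k - 1)) / 6"
  by (induction k) (simp_all add: field_simps)

lemma cycle_transmission:
  assumes "n > 0"
  shows "(\<Sum>i<n. real i * (real n - real i) / real n) = ((real n)\<^sup>2 - 1) / 6"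
  unfolding sum_divide_distrib[symmetric] sum_mult_diff
  using assms by (simp add: field_simps power2_eq_square)

text \<open>Beyond a plain \<open>st\<close>-numbering, \<open>lower\<close> covers
  \<open>t\<close>, \<open>upper\<close> covers \<open>s\<close>, and both avoid the edge between
  \<open>s\<close> and \<open>t\<close>, which stays free to close the ascending walk.\<close>

locale st_numbered_graph = connected_pair_graph +
  fixes N :: "'a \<Rightarrow> nat" and s t :: 'a
  assumes bij_N: "bij_betw N (pverts G) {..<card (pverts G)}"
    and N_s: "N s = 0" and N_t: "N t = card (pverts G) - 1"
    and arc_ts: "(t, s) \<in> parcs G"
    and lower: "\<And>v. v \<in> pverts G \<Longrightarrow> v \<noteq> s \<Longrightarrow>
      \<exists>y. (v, y) \<in> parcs G - {(t, s)} \<and> N y < N v"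
    and upper: "\<And>v. v \<in> pverts G \<Longrightarrow> v \<noteq> t \<Longrightarrow>
      \<exists>z. (v, z) \<in> parcs G - {(s, t)} \<and> N v < N z"
begin

abbreviation n :: nat where "n \<equiv> card (pverts G)"

lemma s_in: "s \<in> pverts G" and t_in: "t \<in> pverts G" and s_neq_t: "s \<noteq> t"
  using arc_ts in_arcsD1 in_arcsD2 no_loops' by blast+

lemma N_less: "v \<in> pverts G \<Longrightarrow> N v < n"
  using bij_N by (auto simp: bij_betw_def)

lemma N_eq_iff: "x \<in> pverts G \<Longrightarrow> y \<in> pverts G \<Longrightarrow> N x = N y \<longleftrightarrow> x = y"
  using bij_N by (auto simp: bij_betw_def inj_on_def)

lemma n_ge_2: "2 \<le> n"
  using N_less[OF s_in] N_s N_t N_eq_iff[OF s_in t_in] s_neq_t by linarith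

text \<open>Since \<open>N\<close> is injective, the descending arcs contain each edge exactly once,
  which removes the factor 2 of \<open>energy_potential\<close>.\<close>

lemma sum_descending_energy:
  assumes "unit_current_potential G u v f" "u \<in> pverts G" "v \<in> pverts G"
  shows "(\<Sum>(p, q) \<in> {(p, q) \<in> parcs G. N q < N p}. (f p - f q)\<^sup>2) = f u - f v"
proof -
  let ?D = "{(p, q) \<in> parcs G. N q < N p}" and ?A = "{(p, q) \<in> parcs G. N p < N q}"
  let ?e = "\<lambda>(p, q). (f p - f q)\<^sup>2"
  have "sum ?e ?A = sum ?e ?D"
    by (rule sum.reindex_bij_witness[where i = prod.swap and j = prod.swap])
      (auto intro: arcs_symmetric simp: power2_commute)
  moreover have parts: "?D \<union> ?A = parcs G"
  proof -
    have "N p \<noteq> N q" if "(p, q) \<in> parcs G" for p q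
      using that N_eq_iff in_arcsD1 in_arcsD2 no_loops' by blast
    then show ?thesis by (auto simp: neq_iff)
  qed
  moreover have "sum ?e (?D \<union> ?A) = sum ?e ?D + sum ?e ?A"
    by (rule sum.union_disjoint) (auto intro: finite_subset[OF _ pair_finite_arcs])
  ultimately show ?thesis
    using energy_potential[OF assms] unfolding parts by simp
qed

text \<open>The two halves of the energy come from a descending walk from \<open>x\<close> to \<open>s\<close> of length at most
  \<open>l x\<close> and from an ascending walk from \<open>x\<close> to \<open>t\<close> closed up by the arc \<open>(t, s)\<close>.\<close>
lemma resistance_distance_le_length:
  assumes x: "x \<in> pverts G" "x \<noteq> s"
    and l: "\<And>v. v \<in> pverts G \<Longrightarrow> v \<noteq> s \<Longrightarrow>
      \<exists>y. (v, y) \<in> parcs G - {(t, s)} \<and> N y < N v \<and> l y < l v"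
  shows "resistance_distance G s x \<le> real (l x) * real (n - N x) / (real (l x) + real (n - N x))"
proof -
  obtain f where f: "unit_current_potential G s x f"
    using unit_current_potential_exists s_in x by blast
  define r where "r = f s - f x"
  let ?e = "\<lambda>(p, q). (f p - f q)\<^sup>2"
  \<comment> \<open>\<open>?D\<close> lies below the level \<open>N x\<close> and \<open>?U\<close>
    above it, so they are disjoint, and neither contains the closing arc.\<close>
  let ?D = "{(p, q) \<in> parcs G - {(t, s)}. N q < N p \<and> N p \<le> N x}"
  let ?U = "{(p, q) \<in> parcs G - {(t, s)}. N q < N p \<and> N x \<le> N q}"
  have fin: "finite ?D" "finite ?U"
    by (auto intro: finite_subset[OF _ pair_finite_arcs])
  have down: "r\<^sup>2 \<le> real (l x) * sum ?e ?D"
  proof -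
    have "(f x - f s)\<^sup>2 \<le> real (l x) * sum ?e ?D"
      by (rule sq_potential_drop_le_descending_energy[where V = "pverts G"])
        (use x l pair_finite_arcs in_arcsD2 in blast)+
    then show ?thesis by (simp add: r_def power2_commute)
  qed
  have up: "(f x - f t)\<^sup>2 \<le> real (n - 1 - N x) * sum ?e ?U"
  proof -
    \<comment> \<open>Reversing the numbers turns the ascent to \<open>t\<close> into a
      descent.\<close>
    let ?M = "\<lambda>v. n - 1 - N v"
    let ?U' = "{(p, q) \<in> parcs G - {(s, t)}. ?M q < ?M p \<and> ?M p \<le> ?M x}"
    have "(f x - f t)\<^sup>2 \<le> real (n - 1 - N x) * sum ?e ?U'"
    proof (rule sq_potential_drop_le_descending_energy[where V = "pverts G"])
      fix v assume v: "v \<in> pverts G" "v \<noteq> t"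
      then obtain z where z: "(v, z) \<in> parcs G - {(s, t)}" "N v < N z"
        using upper by blast
      then have "z \<in> pverts G" by (auto dest: in_arcsD2)
      moreover from this have "?M z < ?M v" using z(2) N_less[of z] by linarith
      ultimately show "\<exists>z \<in> pverts G. (v, z) \<in> parcs G - {(s, t)} \<and> ?M z < ?M v \<and> ?M z < ?M v"
        using z by blast
    qed (use x pair_finite_arcs in auto)
    also have "sum ?e ?U' = sum ?e ?U"
    proof (rule sum.reindex_bij_witness[where i = prod.swap and j = prod.swap])
      have "?M q < ?M p \<and> ?M p \<le> ?M x \<longleftrightarrow> N p < N q \<and> N x \<le> N p"
        if "(p, q) \<in> parcs G" for p q
        using N_less[OF in_arcsD1[OF that]] N_less[OF in_arcsD2[OF that]] N_less[OF x(1)] by auto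
      then show "\<And>a. a \<in> ?U' \<Longrightarrow> prod.swap a \<in> ?U" "\<And>b. b \<in> ?U \<Longrightarrow> prod.swap b \<in> ?U'"
        by (auto dest: arcs_symmetric)
    qed (auto simp: power2_commute)
    finally show ?thesis .
  qed
  have nonneg: "0 \<le> sum ?e ?D" "0 \<le> sum ?e ?U"
    by (auto intro!: sum_nonneg)
  \<comment> \<open>The closing arc adds one to the length \<open>n - 1 - N x\<close>.\<close>
  have "((f x - f t) + (f t - f s))\<^sup>2 \<le> (real (n - 1 - N x) + 1) * (sum ?e ?U + (f t - f s)\<^sup>2)"
    by (rule cauchy_schwarz_step[OF up]) (use nonneg in auto)
  also have "real (n - 1 - N x) + 1 = real (n - N x)"
    using N_less[OF x(1)] by (simp add: of_nat_diff)
  finally have up': "r\<^sup>2 \<le> real (n - N x) * (sum ?e ?U + (f t - f s)\<^sup>2)"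
    by (simp add: r_def power2_commute)
  have "sum ?e ?D + (sum ?e ?U + (f t - f s)\<^sup>2) = sum ?e (?D \<union> ?U \<union> {(t, s)})"
  proof -
    have "sum ?e (?D \<union> ?U \<union> {(t, s)}) = sum ?e (?D \<union> ?U) + sum ?e {(t, s)}"
      by (rule sum.union_disjoint) (use fin in auto)
    also have "sum ?e (?D \<union> ?U) = sum ?e ?D + sum ?e ?U"
      by (rule sum.union_disjoint) (use fin in auto)
    finally show ?thesis by simp
  qed
  also have "\<dots> \<le> sum ?e {(p, q) \<in> parcs G. N q < N p}"
  proof (rule sum_mono2)
    show "finite {(p, q) \<in> parcs G. N q < N p}"
      by (auto intro: finite_subset[OF _ pair_finite_arcs])
    show "?D \<union> ?U \<union> {(t, s)} \<subseteq> {(p, q) \<in> parcs G. N q < N p}"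
      using arc_ts N_s N_t n_ge_2 by auto
  qed auto
  also have "\<dots> = r"
    unfolding r_def by (rule sum_descending_energy) (use f s_in x in auto)
  finally have total: "sum ?e ?D + (sum ?e ?U + (f t - f s)\<^sup>2) \<le> r" .
  have "0 < l x" using l[OF x] by auto
  then have "r \<le> real (l x) * real (n - N x) / (real (l x) + real (n - N x))"
    using le_parallel_resistance[OF down up' total] nonneg N_less[OF x(1)] by simp
  moreover have "resistance_distance G s x = r"
    unfolding r_def using f s_in x(1) by (rule resistance_distance_eq)
  ultimately show ?thesis by simp
qed

text \<open>With \<open>l = N\<close> the two lengths \<open>N x\<close> and \<open>n - N x\<close>
  add up to \<open>n\<close>.\<close>

lemma resistance_distance_le:
  assumes "x \<in> pverts G"
  shows "resistance_distance G s x \<le> real (N x) * (real n - real (N x)) / real n"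
proof (cases "x = s")
  case True
  then show ?thesis by (simp add: resistance_distance_self s_in N_s)
next
  case False
  then show ?thesis
    using resistance_distance_le_length[of x N] assms lower N_less[OF assms]
    by (simp add: of_nat_diff)
qed

text \<open>The skipping arc allows a descent from \<open>t\<close> to \<open>s\<close> of length at
  most \<open>n - 2\<close>, parallel to the edge \<open>ts\<close>, and
  \<open>(n - 2) / (n - 1) < (n - 1) / n\<close>.\<close>

lemma resistance_distance_less_of_skip:
  assumes pq: "(p, q) \<in> parcs G - {(t, s)}" "Suc (N q) < N p"
  shows "resistance_distance G s t < real (N t) * (real n - real (N t)) / real n"
proof -
  \<comment> \<open>Numbers from \<open>N p\<close> upward drop by one. This merges only the levels
    \<open>N p - 1\<close> and \<open>N p\<close>; a step between these would start at
    \<open>p\<close>, where the skipping arc is taken instead.\<close>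
  define l where "l v = (if N v < N p then N v else N v - 1)" for v
  have p: "p \<in> pverts G" using pq in_arcsD1 by blast
  have "\<exists>y. (v, y) \<in> parcs G - {(t, s)} \<and> N y < N v \<and> l y < l v"
    if v: "v \<in> pverts G" "v \<noteq> s" for v
  proof (cases "v = p")
    case True
    with pq show ?thesis by (intro exI[of _ q]) (auto simp: l_def)
  next
    case False
    then have "N v \<noteq> N p" using N_eq_iff v p by blast
    moreover obtain y where "(v, y) \<in> parcs G - {(t, s)}" "N y < N v"
      using lower v by blast
    ultimately show ?thesis using pq(2) by (intro exI[of _ y]) (auto simp: l_def)
  qed
  then have "resistance_distance G s t \<le> real (l t) * real (n - N t) / (real (l t) + real (n - N t))"
    using t_in s_neq_t by (intro resistance_distance_le_length) auto
  moreover have "l t = n - 2" "n - N t = 1"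
    using N_t n_ge_2 N_less[OF p] by (auto simp: l_def)
  moreover have "real (n - 2) / (real (n - 2) + 1) < real (n - 1) / real n"
    using n_ge_2 by (simp add: of_nat_diff field_simps)
  ultimately show ?thesis
    using N_t n_ge_2 by (simp add: of_nat_diff)
qed

lemma sum_resistance_bounds:
  "(\<Sum>x \<in> pverts G. real (N x) * (real n - real (N x)) / real n) = ((real n)\<^sup>2 - 1) / 6"
proof -
  have "(\<Sum>x \<in> pverts G. real (N x) * (real n - real (N x)) / real n) =
      (\<Sum>i<n. real i * (real n - real i) / real n)"
    by (rule sum.reindex_bij_betw[OF bij_N])
  then show ?thesis using cycle_transmission n_ge_2 by simp
qed

lemma transmission_le: "(\<Sum>x \<in> pverts G. resistance_distance G s x) \<le> ((real n)\<^sup>2 - 1) / 6"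
  unfolding sum_resistance_bounds[symmetric] by (intro sum_mono resistance_distance_le)

text \<open>Equal sums force equality at \<open>t\<close>, so no descending arc but
  \<open>(t, s)\<close> skips a number. Conversely, the lower neighbour of a vertex other than
  \<open>s\<close> must then be its predecessor.\<close>

lemma arcs_iff_of_transmission_eq:
  assumes "(\<Sum>x \<in> pverts G. resistance_distance G s x) = ((real n)\<^sup>2 - 1) / 6"
    and x: "x \<in> pverts G" and y: "y \<in> pverts G"
  shows "(x, y) \<in> parcs G \<longleftrightarrow> N y = Suc (N x) mod n \<or> N x = Suc (N y) mod n"
proof -
  have consecutive: "N p = Suc (N q)" if "(p, q) \<in> parcs G - {(t, s)}" "N q < N p" for p q
  proof (rule ccontr)
    assume "N p \<noteq> Suc (N q)"
    then have "resistance_distance G s t < real (N t) * (real n - real (N t)) / real n"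
      using that by (intro resistance_distance_less_of_skip) auto
    then have "(\<Sum>x \<in> pverts G. resistance_distance G s x) < ((real n)\<^sup>2 - 1) / 6"
      unfolding sum_resistance_bounds[symmetric]
      using resistance_distance_le t_in pair_finite_verts by (intro sum_strict_mono_ex1) auto
    with assms(1) show False by simp
  qed
  have descending: "N p = Suc (N q) mod n \<or> N q = Suc (N p) mod n"
    if pq: "(p, q) \<in> parcs G" "N q < N p" for p q
  proof (cases "(p, q) = (t, s)")
    case True
    then show ?thesis using N_s N_t n_ge_2 by simp
  next
    case False
    then show ?thesis using consecutive[of p q] pq N_less[OF in_arcsD1[OF pq(1)]] by simp
  qed
  have successor: "(p, q) \<in> parcs G" if pq: "p \<in> pverts G" "q \<in> pverts G" "N p = Suc (N q) mod n" for p q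
  proof (cases "Suc (N q) < n")
    case True
    then have "N p = Suc (N q)" using pq by simp
    then have "p \<noteq> s" using N_s by auto
    then obtain z where z: "(p, z) \<in> parcs G - {(t, s)}" "N z < N p"
      using lower pq(1) by blast
    then have "N z = N q" using consecutive \<open>N p = Suc (N q)\<close> by fastforce
    then have "z = q" using N_eq_iff pq(2) z(1) in_arcsD2 by blast
    then show ?thesis using z by simp
  next
    case False
    \<comment> \<open>The wrap-around: \<open>q\<close> is \<open>t\<close> and \<open>p\<close> is
      \<open>s\<close>.\<close>
    then have "N q = N t" "N p = N s"
      using pq N_less[OF pq(2)] N_s N_t n_ge_2 by (auto simp: not_less le_Suc_eq)
    then show ?thesis
      using N_eq_iff pq s_in t_in arc_ts arcs_symmetric by blast
  qed
  show ?thesis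
  proof
    assume xy: "(x, y) \<in> parcs G"
    then have "N x \<noteq> N y" using N_eq_iff x y no_loops' by blast
    then show "N y = Suc (N x) mod n \<or> N x = Suc (N y) mod n"
      using descending[of x y] descending[of y x] xy arcs_symmetric[OF xy] by (auto simp: neq_iff)
  next
    assume "N y = Suc (N x) mod n \<or> N x = Suc (N y) mod n"
    then show "(x, y) \<in> parcs G"
      using successor x y arcs_symmetric by blast
  qed
qed

end

text \<open>Take a neighbour of \<open>s\<close> as \<open>t\<close>. The smaller neighbour of
  \<open>t\<close> and the larger one of \<open>s\<close>, not provided by the
  \<open>st\<close>-numbering, are the vertices with the second largest and second smallest
  number.\<close>

lemma (in two_connected_pair_graph) st_numbered_graph_exists:
  assumes "s \<in> pverts G"
  obtains N t where "st_numbered_graph G N s t"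
proof -
  have "pverts G \<noteq> {s}" using card_verts_ge by auto
  then obtain w where w: "w \<in> pverts G" "w \<noteq> s" using assms by blast
  have "(s, w) \<in> rtrancl_on (pverts G) (parcs G)"
    using reachable_all assms w by blast
  then obtain t where t: "(s, t) \<in> parcs G"
    using w(2) by (cases rule: converse_rtrancl_on_cases) auto
  then have t_in: "t \<in> pverts G" and "s \<noteq> t"
    using in_arcsD2 no_loops' by blast+
  obtain N where N: "bij_betw N (pverts G) {..<card (pverts G)}" "N s = 0"
      "N t = card (pverts G) - 1"
      and lower: "\<And>v. v \<in> pverts G - {s, t} \<Longrightarrow> \<exists>y. (v, y) \<in> parcs G \<and> N y < N v"
      and upper: "\<And>v. v \<in> pverts G - {s, t} \<Longrightarrow> \<exists>z. (v, z) \<in> parcs G \<and> N v < N z"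
    using st_numbering_exists[OF assms t_in \<open>s \<noteq> t\<close>] by blast
  have inj: "x = y" if "x \<in> pverts G" "y \<in> pverts G" "N x = N y" for x y
    using N(1) that by (auto simp: bij_betw_def inj_on_def)
  have N_less: "N x < card (pverts G)" if "x \<in> pverts G" for x
    using N(1) that by (auto simp: bij_betw_def)
  have vertex_at: "\<exists>x \<in> pverts G. N x = i" if "i < card (pverts G)" for i
    using N(1) that unfolding bij_betw_def by (metis imageE lessThan_iff)
  have "st_numbered_graph G N s t"
  proof
    show "(t, s) \<in> parcs G" using t by (rule arcs_symmetric)
    fix v assume v: "v \<in> pverts G"
    {
      assume "v \<noteq> s"
      show "\<exists>y. (v, y) \<in> parcs G - {(t, s)} \<and> N y < N v"
      proof (cases "v = t")
        case True
        \<comment> \<open>With at least three vertices this \<open>x\<close> differs from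
          \<open>s\<close>, and its larger neighbour can only be \<open>t\<close>.\<close>
        obtain x where x: "x \<in> pverts G" "N x = card (pverts G) - 2"
          using vertex_at[of "card (pverts G) - 2"] card_verts_ge by auto
        then have "x \<noteq> s" "x \<noteq> t"
          using N(2,3) card_verts_ge by auto
        then obtain z where z: "(x, z) \<in> parcs G" "N x < N z"
          using upper x by blast
        have "N z = N t"
          using z(2) x(2) N(3) N_less[OF in_arcsD2[OF z(1)]] by linarith
        then have "z = t" using inj in_arcsD2[OF z(1)] t_in by blast
        with z True \<open>x \<noteq> s\<close> arcs_symmetric show ?thesis by blast
      next
        case False
        then show ?thesis using lower[of v] v \<open>v \<noteq> s\<close> by blast
      qed
    next
      assume "v \<noteq> t"
      show "\<exists>z. (v, z) \<in> parcs G - {(s, t)} \<and> N v < N z"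
      proof (cases "v = s")
        case True
        obtain x where x: "x \<in> pverts G" "N x = 1"
          using vertex_at[of 1] card_verts_ge by auto
        then have "x \<noteq> s" "x \<noteq> t"
          using N(2,3) card_verts_ge by auto
        then obtain y where y: "(x, y) \<in> parcs G" "N y < N x"
          using lower x by blast
        have "N y = N s"
          using y(2) x(2) N(2) by linarith
        then have "y = s" using inj in_arcsD2[OF y(1)] assms by blast
        with y True \<open>x \<noteq> t\<close> arcs_symmetric show ?thesis by blast
      next
        case False
        then show ?thesis using upper[of v] v \<open>v \<noteq> t\<close> by blast
      qed
    }
  qed (use N in auto)
  then show thesis by (rule that)
qed

section \<open>The cycle\<close>

text \<open>Arcs are pairs of vertices, so the vertex map of an isomorphism determines its arc
  map.\<close>

lemma digraph_iso_with_proj_iff: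
  assumes "pair_wf_digraph G" "pair_wf_digraph H"
  shows "digraph_iso (with_proj G) (with_proj H) \<longleftrightarrow>
    (\<exists>\<phi>. bij_betw \<phi> (pverts G) (pverts H) \<and>
      (\<forall>x \<in> pverts G. \<forall>y \<in> pverts G. (x, y) \<in> parcs G \<longleftrightarrow> (\<phi> x, \<phi> y) \<in> parcs H))"
    (is "?L \<longleftrightarrow> ?R")
proof
  interpret G: pair_wf_digraph G by fact
  assume ?L
  then obtain h where h: "pre_digraph.digraph_isomorphism (with_proj G) h"
      and H: "with_proj H = app_iso h (with_proj G)"
    unfolding digraph_iso_def by blast
  let ?\<phi> = "iso_verts h"
  have inj: "inj_on ?\<phi> (pverts G)"
    using h by (rule G.digraph_isomorphism_inj_on_verts)
  have verts_H: "pverts H = ?\<phi> ` pverts G"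
    using arg_cong[OF H, of verts] by simp
  have arcs_H: "parcs H = (\<lambda>(u, v). (?\<phi> u, ?\<phi> v)) ` parcs G"
    using arg_cong[OF H, of arcs_ends] G.arcs_ends_app_iso_eq[OF h] by simp
  have "(x, y) \<in> parcs G \<longleftrightarrow> (?\<phi> x, ?\<phi> y) \<in> parcs H"
    if xy: "x \<in> pverts G" "y \<in> pverts G" for x y
  proof
    assume "(x, y) \<in> parcs G"
    then show "(?\<phi> x, ?\<phi> y) \<in> parcs H"
      unfolding arcs_H by (rule rev_image_eqI) simp
  next
    assume "(?\<phi> x, ?\<phi> y) \<in> parcs H"
    then obtain u v where uv: "(u, v) \<in> parcs G" "?\<phi> x = ?\<phi> u" "?\<phi> y = ?\<phi> v"
      unfolding arcs_H by auto
    then have "x = u" "y = v"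
      using xy inj G.in_arcsD1[OF uv(1)] G.in_arcsD2[OF uv(1)] by (auto dest: inj_onD)
    with uv(1) show "(x, y) \<in> parcs G" by simp
  qed
  with inj verts_H show ?R
    unfolding bij_betw_def by blast
next
  interpret G: pair_wf_digraph G by fact
  interpret H: pair_wf_digraph H by fact
  assume ?R
  then obtain \<phi> where bij: "bij_betw \<phi> (pverts G) (pverts H)"
      and arcs: "\<And>x y. x \<in> pverts G \<Longrightarrow> y \<in> pverts G \<Longrightarrow>
        (x, y) \<in> parcs G \<longleftrightarrow> (\<phi> x, \<phi> y) \<in> parcs H"
    by blast
  let ?h = "\<lparr>iso_verts = \<phi>, iso_arcs = \<lambda>(x, y). (\<phi> x, \<phi> y), iso_head = snd, iso_tail = fst\<rparr>"
  have inj: "inj_on \<phi> (pverts G)" and im: "\<phi> ` pverts G = pverts H"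
    using bij by (auto simp: bij_betw_def)
  have "pre_digraph.digraph_isomorphism (with_proj G) ?h"
    unfolding pre_digraph.digraph_isomorphism_def
    using inj G.wf_digraph by (auto simp: inj_on_def dest: G.in_arcsD1 G.in_arcsD2)
  moreover have "(\<lambda>(x, y). (\<phi> x, \<phi> y)) ` parcs G = parcs H"
  proof (intro equalityI subsetI)
    fix e assume "e \<in> (\<lambda>(x, y). (\<phi> x, \<phi> y)) ` parcs G"
    then obtain x y where "(x, y) \<in> parcs G" "e = (\<phi> x, \<phi> y)" by auto
    then show "e \<in> parcs H" using arcs G.in_arcsD1 G.in_arcsD2 by blast
  next
    fix e assume "e \<in> parcs H"
    moreover obtain a b where e: "e = (a, b)" by fastforce
    ultimately obtain x y where "x \<in> pverts G" "y \<in> pverts G" "a = \<phi> x" "b = \<phi> y"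
      using im H.in_arcsD1 H.in_arcsD2 by (metis imageE)
    then show "e \<in> (\<lambda>(x, y). (\<phi> x, \<phi> y)) ` parcs G"
      using arcs e \<open>e \<in> parcs H\<close> by (intro rev_image_eqI[of "(x, y)"]) auto
  qed
  then have "with_proj H = app_iso ?h (with_proj G)"
    using im by (simp add: app_iso_def with_proj_def)
  ultimately show ?L
    unfolding digraph_iso_def by blast
qed

section \<open>Green function, resistances and Kirchhoff index of the cycle\<close>

lemma pair_wf_digraph_cycle_graph: "pair_wf_digraph (cycle_graph n)"
  by unfold_locales (auto simp: cycle_graph_def)

lemma Suc_mod_eq: "i < n \<Longrightarrow> Suc i mod n = (if Suc i = n then 0 else Suc i)"
  by (auto simp: mod_less)

text \<open>For \<open>i\<close> and \<open>j\<close> below \<open>n\<close> this is the residue of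
  \<open>j - i\<close> modulo \<open>n\<close>, the forward distance along the cycle.\<close>

definition cyclic_diff :: "nat \<Rightarrow> nat \<Rightarrow> nat \<Rightarrow> nat" where
  "cyclic_diff n i j = (if i \<le> j then j - i else j + n - i)"

lemma bij_betw_cyclic_diff:
  assumes "i < n"
  shows "bij_betw (cyclic_diff n i) {..<n} {..<n}"
proof -
  have "inj_on (cyclic_diff n i) {..<n}"
    using assms by (auto simp: inj_on_def cyclic_diff_def split: if_splits)
  moreover have "cyclic_diff n i ` {..<n} \<subseteq> {..<n}"
    using assms by (auto simp: cyclic_diff_def)
  ultimately show ?thesis
    by (simp add: bij_betw_def endo_inj_surj)
qed

text \<open>The labelling \<open>\<phi>\<close> puts the cycle structure on \<open>G\<close> itself,
  so resistances are computed in \<open>G\<close> and need not be transported along an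
  isomorphism.\<close>

locale cyclic_pair_graph = connected_pair_graph +
  fixes \<phi> :: "'a \<Rightarrow> nat" and n :: nat
  assumes n_ge_3: "3 \<le> n"
    and bij: "bij_betw \<phi> (pverts G) {..<n}"
    and arcs_iff: "\<And>x y. x \<in> pverts G \<Longrightarrow> y \<in> pverts G \<Longrightarrow>
      (x, y) \<in> parcs G \<longleftrightarrow> \<phi> y = Suc (\<phi> x) mod n \<or> \<phi> x = Suc (\<phi> y) mod n"
begin

lemma \<phi>_less: "x \<in> pverts G \<Longrightarrow> \<phi> x < n"
  using bij by (auto simp: bij_betw_def)

lemma \<phi>_eq_iff: "x \<in> pverts G \<Longrightarrow> y \<in> pverts G \<Longrightarrow> \<phi> x = \<phi> y \<longleftrightarrow> x = y"
  using bij by (auto simp: bij_betw_def inj_on_def)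

text \<open>The discrete parabola inverts the Laplacian of the cycle up to the constant \<open>1 / n\<close>.\<close>
definition green :: "nat \<Rightarrow> real" where
  "green m = real m * (real n - real m) / (2 * real n)"

text \<open>The parabola has constant second difference \<open>- 1 / n\<close>; its kink at
  \<open>\<phi> x = j\<close>, where the forward distance wraps around, contributes the remaining
  \<open>- 1\<close>.\<close>

lemma laplacian_green:
  assumes x: "x \<in> pverts G" and j: "j < n"
  shows "laplacian G (\<lambda>x. green (cyclic_diff n j (\<phi> x))) x = 1 / real n - of_bool (\<phi> x = j)"
proof -
  have ex: "\<exists>y \<in> pverts G. \<phi> y = i" if "i < n" for i
    using bij that unfolding bij_betw_def by (metis imageE lessThan_iff)
  note i = \<phi>_less[OF x]
  have "(if Suc (\<phi> x) = n then 0 else Suc (\<phi> x)) < n" "(if \<phi> x = 0 then n - 1 else \<phi> x - 1) < n"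
    using i by auto
  then obtain y z where y: "y \<in> pverts G" "\<phi> y = (if Suc (\<phi> x) = n then 0 else Suc (\<phi> x))"
      and z: "z \<in> pverts G" "\<phi> z = (if \<phi> x = 0 then n - 1 else \<phi> x - 1)"
    using ex by blast
  have "w \<in> {y, z}" if w: "(x, w) \<in> parcs G" for w
  proof -
    have w_in: "w \<in> pverts G" using w by (rule in_arcsD2)
    have "\<phi> w = Suc (\<phi> x) mod n \<or> \<phi> x = Suc (\<phi> w) mod n"
      using w arcs_iff[OF x w_in] by blast
    then have "\<phi> w = \<phi> y \<or> \<phi> w = \<phi> z"
      unfolding Suc_mod_eq[OF i] Suc_mod_eq[OF \<phi>_less[OF w_in]] y(2) z(2)
      by (auto split: if_splits)
    then show ?thesis using \<phi>_eq_iff[OF w_in y(1)] \<phi>_eq_iff[OF w_in z(1)] by blast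
  qed
  moreover have "(x, y) \<in> parcs G"
    unfolding arcs_iff[OF x y(1)] Suc_mod_eq[OF i] using y(2) by blast
  moreover have "(x, z) \<in> parcs G"
    unfolding arcs_iff[OF x z(1)] Suc_mod_eq[OF \<phi>_less[OF z(1)]] using z(2) i n_ge_3 by auto
  ultimately have nbrs: "{w. (x, w) \<in> parcs G} = {y, z}" by blast
  \<comment> \<open>For \<open>n\<close> at least 3 the two cycle neighbours differ, so every vertex
    has degree 2.\<close>
  have "y \<noteq> z" using y(2) z(2) i n_ge_3 by (auto split: if_splits)
  then have lap: "laplacian G f x = 2 * f x - f y - f z" for f
    unfolding laplacian_def nbrs by simp
  define m where "m = cyclic_diff n j (\<phi> x)"
  have m: "m < n" "m = 0 \<longleftrightarrow> \<phi> x = j"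
    using i j by (auto simp: m_def cyclic_diff_def)
  have dy: "cyclic_diff n j (\<phi> y) = (if Suc m = n then 0 else Suc m)"
    using y(2) i j n_ge_3 by (auto simp: m_def cyclic_diff_def split: if_splits)
  have dz: "cyclic_diff n j (\<phi> z) = (if m = 0 then n - 1 else m - 1)"
    using z(2) i j n_ge_3 by (auto simp: m_def cyclic_diff_def split: if_splits)
  \<comment> \<open>The formula covers the wrap-around too, as it vanishes for
    \<open>Suc m = n\<close>; in \<open>gz\<close> the case \<open>m = 0\<close> has to stay
    separate.\<close>
  have gy: "green (if Suc m = n then 0 else Suc m) = (real m + 1) * (real n - real m - 1) / (2 * real n)"
    by (auto simp: green_def algebra_simps)
  have gz: "green (if m = 0 then n - 1 else m - 1) =
      (if m = 0 then real n - 1 else (real m - 1) * (real n - real m + 1)) / (2 * real n)"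
    using n_ge_3 by (auto simp: green_def of_nat_diff)
  have "2 * green m - green (if Suc m = n then 0 else Suc m) - green (if m = 0 then n - 1 else m - 1) =
      1 / real n - of_bool (m = 0)"
    unfolding gy gz unfolding green_def using n_ge_3 by (auto simp: field_simps)
  then show ?thesis
    unfolding lap dy dz m_def[symmetric] m(2) .
qed

text \<open>Subtracting the Green functions with poles at \<open>v\<close> and \<open>u\<close>
  cancels the constants \<open>1 / n\<close> and leaves a unit current from \<open>u\<close> to
  \<open>v\<close>.\<close>

lemma resistance_distance_cycle:
  assumes u: "u \<in> pverts G" and v: "v \<in> pverts G"
  defines "d \<equiv> cyclic_diff n (\<phi> u) (\<phi> v)"
  shows "resistance_distance G u v = real d * (real n - real d) / real n"
proof -
  let ?h = "\<lambda>w x. green (cyclic_diff n (\<phi> w) (\<phi> x))"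
  have "unit_current_potential G u v (\<lambda>x. ?h v x - ?h u x)"
    unfolding unit_current_potential_iff laplacian_diff
    using u v by (auto simp: laplacian_green \<phi>_less \<phi>_eq_iff)
  then have "resistance_distance G u v = (?h v u - ?h u u) - (?h v v - ?h u v)"
    using u v by (rule resistance_distance_eq)
  \<comment> \<open>The parabola is symmetric under \<open>m \<mapsto> n - m\<close>.\<close>
  also have "?h v u = ?h u v"
    using \<phi>_less[OF u] \<phi>_less[OF v] by (auto simp: cyclic_diff_def green_def of_nat_diff)
  finally show ?thesis
    by (simp add: d_def green_def cyclic_diff_def)
qed

lemma Kirchhoff_index_cycle: "Kirchhoff_index G = (real n ^ 3 - real n) / 12"
proof -
  have transmission: "(\<Sum>v \<in> pverts G. resistance_distance G u v) = ((real n)\<^sup>2 - 1) / 6"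
    if u: "u \<in> pverts G" for u
  proof -
    let ?t = "\<lambda>d. real d * (real n - real d) / real n"
    have "bij_betw (cyclic_diff n (\<phi> u) \<circ> \<phi>) (pverts G) {..<n}"
      using bij bij_betw_cyclic_diff[OF \<phi>_less[OF u]] by (rule bij_betw_trans)
    then have "(\<Sum>v \<in> pverts G. ?t ((cyclic_diff n (\<phi> u) \<circ> \<phi>) v)) = (\<Sum>d<n. ?t d)"
      by (rule sum.reindex_bij_betw)
    then show ?thesis
      using u n_ge_3 by (simp add: resistance_distance_cycle cycle_transmission)
  qed
  have "card (pverts G) = n"
    using bij_betw_same_card[OF bij] by simp
  then have "Kirchhoff_index G = real n * (((real n)\<^sup>2 - 1) / 6) / 2"
    unfolding Kirchhoff_index_eq_sum by (subst sum.cong[OF refl transmission]) simp_all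
  then show ?thesis
    by (simp add: power2_eq_square power3_eq_cube algebra_simps)
qed

end

section \<open>The extremal theorem\<close>

theorem theorem2p9:
  fixes G :: "'a pair_pre_digraph" and n :: nat
  assumes "pair_graph G"
    and "two_connected G"
    and "card (pverts G) = n"
  shows "Kirchhoff_index G \<le> (real n ^ 3 - real n) / 12 \<and>
    (Kirchhoff_index G = (real n ^ 3 - real n) / 12 \<longleftrightarrow>
      digraph_iso (with_proj G) (with_proj (cycle_graph n)))"
proof -
  interpret two_connected_pair_graph G
    using assms(1,2) by (simp add: two_connected_pair_graph_def two_connected_pair_graph_axioms_def)
  let ?c = "((real n)\<^sup>2 - 1) / 6" and ?T = "\<lambda>u. \<Sum>v \<in> pverts G. resistance_distance G u v"
  have T_le: "?T u \<le> ?c" if "u \<in> pverts G" for u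
    using st_numbered_graph_exists[OF that] st_numbered_graph.transmission_le assms(3) by metis
  have bound: "(real n ^ 3 - real n) / 12 = (\<Sum>u \<in> pverts G. ?c) / 2"
    using assms(3) by (simp add: power2_eq_square power3_eq_cube algebra_simps)
  have "Kirchhoff_index G \<le> (real n ^ 3 - real n) / 12"
    unfolding bound Kirchhoff_index_eq_sum using T_le by (intro divide_right_mono sum_mono) auto
  moreover have "digraph_iso (with_proj G) (with_proj (cycle_graph n))"
    if eq: "Kirchhoff_index G = (real n ^ 3 - real n) / 12"
  proof -
    obtain s where s: "s \<in> pverts G"
      using card_verts_ge by fastforce
    have "sum ?T (pverts G) = (\<Sum>u \<in> pverts G. ?c)"
      using eq unfolding bound Kirchhoff_index_eq_sum by simp
    \<comment> \<open>A sum that attains its termwise bound attains it in every term; a single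
      vertex \<open>s\<close> suffices to recover the cycle.\<close>
    then have "?T s = ?c"
      using sum_mono_inv[of ?T "pverts G" "\<lambda>_. ?c" s] T_le s pair_finite_verts by blast
    obtain N t where "st_numbered_graph G N s t"
      using st_numbered_graph_exists[OF s] .
    then interpret st: st_numbered_graph G N s t .
    have "(x, y) \<in> parcs G \<longleftrightarrow> (N x, N y) \<in> parcs (cycle_graph n)"
      if "x \<in> pverts G" "y \<in> pverts G" for x y
      using st.arcs_iff_of_transmission_eq[of x y] \<open>?T s = ?c\<close> that st.N_less assms(3)
      by (auto simp: cycle_graph_def)
    then show ?thesis
      using st.bij_N assms(3) pair_wf_digraph pair_wf_digraph_cycle_graph
      by (subst digraph_iso_with_proj_iff) (auto simp: cycle_graph_def)
  qed
  moreover have "Kirchhoff_index G = (real n ^ 3 - real n) / 12"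
    if iso: "digraph_iso (with_proj G) (with_proj (cycle_graph n))"
  proof -
    obtain \<phi> where "bij_betw \<phi> (pverts G) (pverts (cycle_graph n))"
        and arcs: "\<And>x y. x \<in> pverts G \<Longrightarrow> y \<in> pverts G \<Longrightarrow>
          (x, y) \<in> parcs G \<longleftrightarrow> (\<phi> x, \<phi> y) \<in> parcs (cycle_graph n)"
      using iso digraph_iso_with_proj_iff[OF pair_wf_digraph pair_wf_digraph_cycle_graph, of n]
      by blast
    then have bij: "bij_betw \<phi> (pverts G) {..<n}"
      by (simp add: cycle_graph_def)
    have "\<phi> x < n" if "x \<in> pverts G" for x
      using bij that by (auto simp: bij_betw_def)
    with arcs interpret cyclic_pair_graph G \<phi> n
      using bij card_verts_ge assms(3) by unfold_locales (auto simp: cycle_graph_def)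
    show ?thesis by (rule Kirchhoff_index_cycle)
  qed
  ultimately show ?thesis by blast
qed

end
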